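(* Let $\mathcal G$ be a hypergraph with $c:=\operatorname{crk}(\mathcal G)\ge 3$ and $k:=\operatorname{rk}(\mathcal G)$. If the incidence graph $\mathscr I(\mathcal G)$ is $\left(1+\lceil k/c\rceil\right)$-edge-connected (equivalently, in the paper's terminology, $\mathcal G$ is $\left(1+\lceil k/c\rceil\right)$-flag-connected), then $\mathcal G$ is quasi-Eulerian.
   Context: A hypergraph $\mathcal G=(V,E)$ consists of a finite vertex set $V$ and a finite multiset $E$ of nonempty subsets of $V$ (edges; repeated edges allowed). $\operatorname{rk}(\mathcal G)=\max\{|e|:e\in E\}$ and $\operatorname{crk}(\mathcal G)=\min\{|e|:e\in E\}$. The incidence graph $\mathscr I(\mathcal G)$ is the simple bipartite graph with one part $V$, the other part having one vertex for each member of the multiset $E$, and $v$ adjacent to $e$ iff $v\in e$. A closed walk in $\mathcal G$ is a cyclic sequence $v_1,e_1,v_2,e_2,\dots,v_t,e_t$ of vertices $v_i$ and edges $e_i$ with $\{v_i,v_{i+1}\}\subseteq e_i$ and $v_i\neq v_{i+1}$ for all $i$ (indices modulo $t$). An Euler family is a finite family of closed walks such that every edge of $\mathcal G$ (each member of the multiset $E$) occurs exactly once in total among the edge-entries of all the walks; $\mathcal G$ is quasi-Eulerian if it has an Euler family. Equivalently, $\mathcal G$ is quasi-Eulerian iff $\mathscr I(\mathcal G)$ has a subgraph in which every vertex has even degree and every vertex corresponding to an edge of $\mathcal G$ has degree exactly $2$. *)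

theory Defs
  imports Complex_Main
begin

text \<open>A hypergraph is given by a vertex set V, a set E of edge identifiers (so that the
  multiset of edges is represented by the family inc e, e in E; repeated edges are distinct
  identifiers with equal inc), and the incidence map inc.\<close>

definition hypergraph :: "'v set \<Rightarrow> 'e set \<Rightarrow> ('e \<Rightarrow> 'v set) \<Rightarrow> bool" where
  "hypergraph V E inc \<longleftrightarrow> finite V \<and> finite E \<and> (\<forall>e\<in>E. inc e \<noteq> {} \<and> inc e \<subseteq> V)"

definition rk :: "'e set \<Rightarrow> ('e \<Rightarrow> 'v set) \<Rightarrow> nat" where
  "rk E inc = Max ((\<lambda>e. card (inc e)) ` E)"

definition crk :: "'e set \<Rightarrow> ('e \<Rightarrow> 'v set) \<Rightarrow> nat" where
  "crk E inc = Min ((\<lambda>e. card (inc e)) ` E)"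

text \<open>Edges of the incidence graph (flags): pairs (v,e) with v in inc e.
  The incidence graph has vertex set Inl ` V \<union> Inr ` E.\<close>

definition flags :: "'e set \<Rightarrow> ('e \<Rightarrow> 'v set) \<Rightarrow> ('v \<times> 'e) set" where
  "flags E inc = {(v, e). e \<in> E \<and> v \<in> inc e}"

definition inc_adj :: "('v \<times> 'e) set \<Rightarrow> (('v + 'e) \<times> ('v + 'e)) set" where
  "inc_adj F = {(Inl v, Inr e) | v e. (v, e) \<in> F} \<union> {(Inr e, Inl v) | v e. (v, e) \<in> F}"

text \<open>The bipartite graph on Inl ` V \<union> Inr ` E with edge set F (F a set of flags) is connected.\<close>
definition inc_connected :: "'v set \<Rightarrow> 'e set \<Rightarrow> ('v \<times> 'e) set \<Rightarrow> bool" where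
  "inc_connected V E F \<longleftrightarrow>
     (\<forall>x \<in> Inl ` V \<union> Inr ` E. \<forall>y \<in> Inl ` V \<union> Inr ` E. (x, y) \<in> (inc_adj F)\<^sup>*)"

text \<open>The incidence graph is l-edge-connected: deleting fewer than l of its edges leaves it connected.\<close>
definition incidence_edge_connected :: "nat \<Rightarrow> 'v set \<Rightarrow> 'e set \<Rightarrow> ('e \<Rightarrow> 'v set) \<Rightarrow> bool" where
  "incidence_edge_connected l V E inc \<longleftrightarrow>
     (\<forall>S \<subseteq> flags E inc. card S < l \<longrightarrow> inc_connected V E (flags E inc - S))"

text \<open>A closed walk v1,e1,...,vt,et is a nonempty list of pairs (v_i, e_i), read cyclically.\<close>
definition closed_walk :: "'v set \<Rightarrow> 'e set \<Rightarrow> ('e \<Rightarrow> 'v set) \<Rightarrow> ('v \<times> 'e) list \<Rightarrow> bool" where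
  "closed_walk V E inc W \<longleftrightarrow> W \<noteq> [] \<and>
     (\<forall>i < length W. fst (W ! i) \<in> V \<and> snd (W ! i) \<in> E \<and>
        {fst (W ! i), fst (W ! ((i + 1) mod length W))} \<subseteq> inc (snd (W ! i)) \<and>
        fst (W ! i) \<noteq> fst (W ! ((i + 1) mod length W)))"

text \<open>An Euler family: finite family of closed walks in which every edge occurs exactly once.\<close>
definition euler_family :: "'v set \<Rightarrow> 'e set \<Rightarrow> ('e \<Rightarrow> 'v set) \<Rightarrow> ('v \<times> 'e) list list \<Rightarrow> bool" where
  "euler_family V E inc Ws \<longleftrightarrow> (\<forall>W \<in> set Ws. closed_walk V E inc W) \<and>
     (\<forall>e \<in> E. count_list (map snd (concat Ws)) e = 1)"

definition quasi_eulerian :: "'v set \<Rightarrow> 'e set \<Rightarrow> ('e \<Rightarrow> 'v set) \<Rightarrow> bool" where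
  "quasi_eulerian V E inc \<longleftrightarrow> (\<exists>Ws. euler_family V E inc Ws)"

end

theory Submission
  imports Defs "HOL-Library.Multiset"
begin

text \<open>An Euler family pairs up flags at the vertices (the transitions of the walks) so that exactly two
  flags at each edge are paired. Adding to every edge e a set of card (inc e) - 2 dummies that absorb
  the other flags at e turns this into a perfect matching problem, to which Tutte's theorem applies.
  For a barrier S in this gadget graph, every odd part receives charge at least 1 from S: a flag in S
  gives 2/k to its vertex and 1 - 2/k to its edge, a dummy in S gives 1 to its edge, and an edge whose
  dummies all lie in S passes 1 - 2/c on to the vertex of each of its flags outside S. In the main case
  a part has a + b boundary flags in the incidence graph, worth at least 1 - 2/c and 2/k respectively,
  where a is odd by parity and a + b \<ge> 1 + k/c by connectivity; so it gets at least 1 both when a = 1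
  and when a \<ge> 3. An edge with all its flags in S can pay for its isolated dummies,
  because d - 2d/k \<ge> d - 2 for d = card (inc e).\<close>

section \<open>Matchings in induced subgraphs\<close>

text \<open>The edge set \<open>G\<close> is never cut down to \<open>W\<close>: deleting vertices
  changes only \<open>W\<close>, so an induction on \<open>W\<close> can keep one \<open>G\<close>
  throughout.\<close>

definition matching :: "'a set set \<Rightarrow> 'a set \<Rightarrow> 'a set set \<Rightarrow> bool" where
  "matching G W M \<longleftrightarrow> M \<subseteq> G \<and> \<Union>M \<subseteq> W \<and> pairwise disjnt M"

text \<open>Size is counted in covered vertices, which is what the deficiency
  \<open>card (W - \<Union>M)\<close> compares; for two-element edges this is the usual notion by
  \<open>card_Union_matching\<close>.\<close>

definition max_matching :: "'a set set \<Rightarrow> 'a set \<Rightarrow> 'a set set \<Rightarrow> bool" where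
  "max_matching G W M \<longleftrightarrow>
     matching G W M \<and> (\<forall>N. matching G W N \<longrightarrow> card (\<Union>N) \<le> card (\<Union>M))"

lemma finite_matching: "finite W \<Longrightarrow> matching G W M \<Longrightarrow> finite M \<and> finite (\<Union>M)"
  unfolding matching_def by (meson finite_UnionD finite_subset)

lemma card_Union_matching:
  assumes "finite W" "\<forall>e\<in>G. card e = 2" "matching G W M"
  shows "card (\<Union>M) = 2 * card M"
proof -
  have M: "M \<subseteq> G" "pairwise disjnt M" using assms(3) by (auto simp: matching_def)
  have "card (\<Union>M) = sum card M"
    using finite_matching[OF assms(1,3)] M(2) by (intro card_Union_disjoint) (auto intro: finite_subset)
  also have "\<dots> = sum (\<lambda>_. 2) M" using M(1) assms(2) by (intro sum.cong) auto
  finally show ?thesis by simp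
qed

lemma matching_edge:
  assumes "\<forall>e\<in>G. card e = 2" "matching G W M" "x \<in> \<Union>M"
  obtains y where "{x, y} \<in> M" "x \<noteq> y"
proof -
  from assms(3) obtain e where e: "e \<in> M" "x \<in> e" by blast
  with assms have "card e = 2" by (auto simp: matching_def)
  with e(2) obtain y where "e = {x, y}" "x \<noteq> y" by (auto simp: card_2_iff)
  with e that show ?thesis by blast
qed

lemma matching_unique:
  "matching G W M \<Longrightarrow> h \<in> M \<Longrightarrow> h' \<in> M \<Longrightarrow> x \<in> h \<Longrightarrow> x \<in> h' \<Longrightarrow> h = h'"
  unfolding matching_def pairwise_def disjnt_def by blast

lemma matching_insert:
  assumes "matching G W M" "e \<in> G" "e \<subseteq> W" "e \<inter> \<Union>M = {}"
  shows "matching G W (insert e M)"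
proof -
  have "\<forall>h\<in>M. disjnt e h \<and> disjnt h e" using assms(4) by (auto simp: disjnt_def)
  then show ?thesis using assms(1-3) by (simp add: matching_def pairwise_insert)
qed

lemma matching_subset: "matching G W M \<Longrightarrow> N \<subseteq> M \<Longrightarrow> matching G W N"
  unfolding matching_def by (meson Union_mono pairwise_subset subset_trans)

lemma ex_max_matching:
  assumes "finite W"
  shows "\<exists>M. max_matching G W M"
proof -
  have "matching G W {}" by (simp add: matching_def)
  moreover have "\<forall>M. matching G W M \<longrightarrow> card (\<Union>M) \<le> card W"
    using assms by (auto simp: matching_def intro: card_mono)
  ultimately show ?thesis unfolding max_matching_def
    using ex_has_greatest_nat[of "matching G W" "{}" "\<lambda>M. card (\<Union>M)" "Suc (card W)"]
    by (auto simp: less_Suc_eq_le)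
qed

lemma max_matching_card:
  "max_matching G W M \<Longrightarrow> max_matching G W N \<Longrightarrow> card (\<Union>M) = card (\<Union>N)"
  unfolding max_matching_def by (meson le_antisym)

lemma max_matching_edge:
  assumes "finite W" "max_matching G W M" "e \<in> G" "card e = 2" "e \<subseteq> W"
  shows "e \<inter> \<Union>M \<noteq> {}"
proof
  assume e: "e \<inter> \<Union>M = {}"
  have "matching G W (insert e M)"
    using assms e by (intro matching_insert) (auto simp: max_matching_def)
  then have "card (e \<union> \<Union>M) \<le> card (\<Union>M)" using assms(2) by (auto simp: max_matching_def)
  moreover have "card (e \<union> \<Union>M) = card e + card (\<Union>M)"
    using e assms finite_matching[of W G M]
    by (intro card_Un_disjoint) (auto simp: max_matching_def intro: finite_subset)
  ultimately show False using assms(4) by simp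
qed

section \<open>Gallai's lemma and the Tutte-Berge formula\<close>

text \<open>Gallai's lemma: if every vertex is missed by some maximum matching, then ``no maximum matching
  misses both'' is a transitive relation. The proof takes N closest to M among the maximum matchings
  missing t and exchanges one edge.\<close>
lemma gallai:
  assumes fin: "finite W" and G: "\<forall>e\<in>G. card e = 2"
    and M: "max_matching G W M" "u \<in> W" "v \<in> W" "u \<notin> \<Union>M" "v \<notin> \<Union>M" "u \<noteq> v"
    and t: "max_matching G W N0" "t \<notin> \<Union>N0"
  shows "\<exists>N. max_matching G W N \<and> t \<notin> \<Union>N \<and> (u \<notin> \<Union>N \<or> v \<notin> \<Union>N)"
proof (rule ccontr)
  assume neg: "\<not> ?thesis"
  let ?Q = "\<lambda>N. max_matching G W N \<and> t \<notin> \<Union>N"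
  have finM: "finite M" "finite (\<Union>M)"
    using finite_matching[OF fin] M(1) by (auto simp: max_matching_def)
  have "\<forall>N. ?Q N \<longrightarrow> card (M \<inter> N) \<le> card M"
    using finM by (simp add: card_mono)
  then obtain N where N: "?Q N" and Nmax: "\<And>N'. ?Q N' \<Longrightarrow> card (M \<inter> N') \<le> card (M \<inter> N)"
    using t ex_has_greatest_nat[of ?Q N0 "\<lambda>N. card (M \<inter> N)" "Suc (card M)"]
    by (auto simp: less_Suc_eq_le)
  have mN: "matching G W N" and mM: "matching G W M" using N M by (auto simp: max_matching_def)
  have finN: "finite N" "finite (\<Union>N)" using finite_matching[OF fin mN] by auto
  have uv: "u \<in> \<Union>N" "v \<in> \<Union>N" using neg N by blast+
  \<comment> \<open>\<open>N\<close> covers \<open>u\<close> and \<open>v\<close>, which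
    \<open>M\<close> misses, and both matchings cover equally many vertices. So \<open>M\<close>
    covers at least two vertices missed by \<open>N\<close>, one of them different from
    \<open>t\<close>.\<close>
  have "\<exists>x\<in>\<Union>M - \<Union>N. x \<noteq> t"
  proof (rule ccontr)
    assume "\<not> ?thesis"
    then have "\<Union>M \<subseteq> insert t (\<Union>N - {u, v})" using M by auto
    then have "card (\<Union>M) \<le> card (insert t (\<Union>N - {u, v}))"
      by (intro card_mono) (use finN in auto)
    also have "\<dots> \<le> Suc (card (\<Union>N - {u, v}))" by (simp add: card_insert_le_m1 card_insert_if finN)
    also have "card (\<Union>N - {u, v}) = card (\<Union>N) - 2"
      using uv M(6) by (subst card_Diff_subset) auto
    finally have "card (\<Union>M) \<le> Suc (card (\<Union>N) - 2)" .
    moreover have "card {u, v} \<le> card (\<Union>N)" using uv by (intro card_mono finN) auto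
    ultimately show False
      using max_matching_card[OF M(1), of N] N M(6) by simp
  qed
  then obtain x where x: "x \<in> \<Union>M" "x \<notin> \<Union>N" "x \<noteq> t" by blast
  from matching_edge[OF G mM x(1)] obtain y where y: "{x, y} \<in> M" "x \<noteq> y" by blast
  have e: "{x, y} \<in> G" "{x, y} \<subseteq> W" using y mM by (auto simp: matching_def)
  have yN: "y \<in> \<Union>N" using max_matching_edge[OF fin, of G N "{x,y}"] N e G x(2) by auto
  from matching_edge[OF G mN yN] obtain z where z: "{y, z} \<in> N" "y \<noteq> z" by blast
  \<comment> \<open>Trading \<open>{y, z}\<close> for \<open>{x, y}\<close> keeps the number of
    edges, hence maximality, and still misses \<open>t\<close>; the result shares one more edge with
    \<open>M\<close>, against the choice of \<open>N\<close>.\<close>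
  let ?N = "insert {x, y} (N - {{y, z}})"
  have UN: "\<Union>(N - {{y, z}}) = \<Union>N - {y, z}"
  proof -
    have "h \<inter> {y, z} = {}" if "h \<in> N" "h \<noteq> {y, z}" for h
      using matching_unique[OF mN that(1) z(1)] that(2) by auto
    then show ?thesis using z by blast
  qed
  have mN': "matching G W ?N"
  proof (rule matching_insert[OF matching_subset[OF mN]])
    show "{x, y} \<inter> \<Union>(N - {{y, z}}) = {}" unfolding UN using x by auto
  qed (use e in auto)
  have xz: "{x, y} \<notin> N" "z \<in> \<Union>N" using x z by auto
  have "card ?N = card N" using finN xz(1) card_Suc_Diff1[OF finN(1) z(1)] by simp
  then have "max_matching G W ?N"
    using mN' N card_Union_matching[OF fin G mN'] card_Union_matching[OF fin G mN]
    unfolding max_matching_def by simp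
  moreover have "t \<notin> \<Union>?N" using N x yN UN by auto
  ultimately have "card (M \<inter> ?N) \<le> card (M \<inter> N)" using Nmax by blast
  moreover have "M \<inter> ?N = insert {x, y} (M \<inter> N)"
  proof -
    have "{y, z} \<notin> M"
    proof
      assume "{y, z} \<in> M"
      then have "{y, z} = {x, y}" using matching_unique[OF mM _ y(1), of _ y] by blast
      then show False using x z by auto
    qed
    then show ?thesis using y by blast
  qed
  ultimately show False using finN xz(1) by simp
qed

text \<open>The parts need not be connected, only closed under adjacency.\<close>
definition odd_parts :: "'a set set \<Rightarrow> 'a set \<Rightarrow> 'a set set \<Rightarrow> bool" where
  "odd_parts G W P \<longleftrightarrow> pairwise disjnt P \<and>
     (\<forall>D\<in>P. D \<subseteq> W \<and> odd (card D) \<and> (\<forall>x\<in>D. \<forall>y\<in>W. {x, y} \<in> G \<longrightarrow> y \<in> D))"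

text \<open>The hard half of the Tutte-Berge formula. A vertex that lies in every maximum matching
  is put into the barrier; if there is none, the empty barrier works, and the relation from Gallai's
  lemma cuts out one odd part around each missed vertex.\<close>

theorem tutte_berge:
  assumes "finite W" and G: "\<forall>e\<in>G. card e = 2" and "max_matching G W M"
  shows "\<exists>U P. U \<subseteq> W \<and> odd_parts G (W - U) P \<and> card U + card (W - \<Union>M) \<le> card P"
  using assms(1,3)
proof (induction "card W" arbitrary: W M)
  case 0
  then show ?case by (intro exI[of _ "{}"]) (auto simp: odd_parts_def)
next
  case (Suc n)
  note fin = \<open>finite W\<close> and M = \<open>max_matching G W M\<close>
  have mM: "matching G W M" using M by (simp add: max_matching_def)
  show ?case
  proof (cases "\<exists>w\<in>W. \<forall>N. max_matching G W N \<longrightarrow> w \<in> \<Union>N")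
    case True
    then obtain w where w: "w \<in> W" "\<And>N. max_matching G W N \<Longrightarrow> w \<in> \<Union>N" by blast
    obtain M' where M': "max_matching G (W - {w}) M'"
      using ex_max_matching[of "W - {w}"] fin by auto
    have "n = card (W - {w})" using Suc(2) w(1) fin by simp
    from Suc(1)[OF this _ M'] fin obtain U P
      where UP: "U \<subseteq> W - {w}" "odd_parts G (W - {w} - U) P"
        "card U + card (W - {w} - \<Union>M') \<le> card P" by auto
    have mM': "matching G W M'" and wM': "w \<notin> \<Union>M'" "\<Union>M' \<subseteq> W"
      using M' by (auto simp: max_matching_def matching_def)
    \<comment> \<open>Maximum matchings all cover \<open>w\<close>, so \<open>M'\<close> falls short
      by at least one edge, that is two vertices, while \<open>W - {w}\<close> has only one vertex
      less. The deficiency grows by at least one, which pays for \<open>w\<close> in the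
      barrier.\<close>
    have "\<not> max_matching G W M'" using w wM' by blast
    then have "card (\<Union>M') < card (\<Union>M)"
      using M mM' unfolding max_matching_def by (meson le_trans not_le)
    then have lt: "card (\<Union>M') + 2 \<le> card (\<Union>M)"
      using card_Union_matching[OF fin G mM] card_Union_matching[OF fin G mM'] by simp
    have "card (W - \<Union>M) = card W - card (\<Union>M)" "card (\<Union>M) \<le> card W"
      using mM fin by (auto simp: matching_def intro!: card_mono card_Diff_subset intro: finite_subset)
    moreover have "card (W - {w} - \<Union>M') = card (W - {w}) - card (\<Union>M')"
      "card (\<Union>M') \<le> card (W - {w})"
      using M' fin
      by (auto simp: max_matching_def matching_def intro!: card_mono card_Diff_subset intro: finite_subset)
    moreover have "card (W - {w}) = card W - 1" "card W > 0" using w(1) fin Suc by auto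
    ultimately have "card (W - \<Union>M) + 1 \<le> card (W - {w} - \<Union>M')" using lt by linarith
    moreover have "card (insert w U) = card U + 1"
      using UP(1) fin by (subst card_insert_disjoint) (auto intro: finite_subset)
    moreover have "W - insert w U = W - {w} - U" by blast
    ultimately show ?thesis using UP w(1)
      by (intro exI[of _ "insert w U"] exI[of _ P]) auto
  next
    case False
    \<comment> \<open>Adjacent vertices are related, and Gallai's lemma gives transitivity, since in
      this case every vertex of \<open>W\<close> is missed by some maximum matching.\<close>
    define R where "R x y \<longleftrightarrow> x = y \<or> \<not> (\<exists>N. max_matching G W N \<and> x \<notin> \<Union>N \<and> y \<notin> \<Union>N)" for x y
    have R_sym: "R x y \<Longrightarrow> R y x" for x y unfolding R_def by blast
    have R_trans: "R x z" if xyz: "R x y" "R y z" "x \<in> W" "y \<in> W" "z \<in> W" for x y z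
    proof (rule ccontr)
      assume neg: "\<not> R x z"
      then obtain N where N: "max_matching G W N" "x \<notin> \<Union>N" "z \<notin> \<Union>N" "x \<noteq> z"
        unfolding R_def by blast
      obtain N0 where N0: "max_matching G W N0" "y \<notin> \<Union>N0" using False xyz(4) by blast
      obtain N' where N': "max_matching G W N'" "y \<notin> \<Union>N'" "x \<notin> \<Union>N' \<or> z \<notin> \<Union>N'"
        using gallai[OF fin G N(1) xyz(3,5) N(2-4) N0] by blast
      have "\<not> R x y \<or> \<not> R y z"
      proof (cases "x = y \<or> y = z")
        case True
        then show ?thesis using neg xyz(1,2) by auto
      next
        case False
        then show ?thesis using N' unfolding R_def by blast
      qed
      then show False using xyz(1,2) by blast
    qed
    have R_edge: "R x y" if "{x, y} \<in> G" "x \<in> W" "y \<in> W" for x y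
      using max_matching_edge[OF fin, of G _ "{x,y}"] that G unfolding R_def by blast
    define cls where "cls x = {y \<in> W. R x y}" for x
    have cls_eq: "cls x = cls y" if "x \<in> W" "y \<in> W" "z \<in> cls x" "z \<in> cls y" for x y z
    proof -
      have "R x y" using that R_trans[of x z y] R_sym[of y z] by (auto simp: cls_def)
      then show ?thesis
        using that(1,2) R_trans[of x y] R_trans[of y x] R_sym[of x y] by (auto simp: cls_def)
    qed
    have inj: "x = y" if "x \<in> W - \<Union>M" "y \<in> W - \<Union>M" "R x y" for x y
      using that M unfolding R_def by blast
    \<comment> \<open>\<open>M\<close> misses only \<open>u\<close> in the class of
      \<open>u\<close>, and adjacent vertices are related, so \<open>M\<close> pairs up the rest of
      the class within itself.\<close>
    have odd: "odd (card (cls u))" if u: "u \<in> W - \<Union>M" for u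
    proof -
      let ?M = "{h \<in> M. h \<subseteq> cls u}"
      have "cls u - {u} = \<Union>?M"
      proof (intro equalityI subsetI)
        fix x assume x: "x \<in> cls u - {u}"
        then have xM: "x \<in> \<Union>M" using inj[of u x] u unfolding cls_def by auto
        from matching_edge[OF G mM this] obtain y where y: "{x, y} \<in> M" by blast
        then have "{x, y} \<in> G" "x \<in> W" "y \<in> W" using mM by (auto simp: matching_def)
        then have "R x y" "y \<in> W" using R_edge by auto
        then have "y \<in> cls u" using x u R_trans unfolding cls_def by blast
        then show "x \<in> \<Union>?M" using x y by blast
      next
        fix x assume "x \<in> \<Union>?M"
        then show "x \<in> cls u - {u}" using u by blast
      qed
      moreover have "matching G W ?M" by (rule matching_subset[OF mM]) auto
      ultimately have "even (card (cls u - {u}))" using card_Union_matching[OF fin G] by simp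
      moreover have "u \<in> cls u" "finite (cls u)" using u fin by (auto simp: cls_def R_def)
      ultimately show ?thesis by (metis card_Suc_Diff1 even_Suc)
    qed
    have "odd_parts G (W - {}) (cls ` (W - \<Union>M))"
      unfolding odd_parts_def
    proof (intro conjI ballI)
      show "pairwise disjnt (cls ` (W - \<Union>M))"
        unfolding pairwise_def disjnt_def using cls_eq by blast
    next
      fix D assume "D \<in> cls ` (W - \<Union>M)"
      then obtain u where u: "u \<in> W - \<Union>M" "D = cls u" by blast
      then show "D \<subseteq> W - {}" "odd (card D)" using odd[of u] by (auto simp: cls_def)
      fix x y assume xy: "x \<in> D" "y \<in> W - {}"
      then have "x \<in> W" "R u x" using u(2) by (auto simp: cls_def)
      then show "{x, y} \<in> G \<longrightarrow> y \<in> D"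
        using u xy(2) R_edge[of x y] R_trans[of u x y] by (auto simp: cls_def)
    qed
    moreover have "inj_on cls (W - \<Union>M)"
    proof (rule inj_onI)
      fix x y assume *: "x \<in> W - \<Union>M" "y \<in> W - \<Union>M" "cls x = cls y"
      then have "y \<in> cls x" by (auto simp: cls_def R_def)
      then show "x = y" using inj * by (auto simp: cls_def)
    qed
    ultimately show ?thesis
      by (intro exI[of _ "{}"] exI[of _ "cls ` (W - \<Union>M)"]) (auto simp: card_image)
  qed
qed

corollary tutte:
  assumes "finite W" "\<forall>e\<in>G. card e = 2"
    and "\<And>U P. U \<subseteq> W \<Longrightarrow> odd_parts G (W - U) P \<Longrightarrow> card P \<le> card U"
  obtains M where "matching G W M" "\<Union>M = W"
proof -
  obtain M where M: "max_matching G W M" using ex_max_matching[OF assms(1)] by blast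
  obtain U P where "U \<subseteq> W" "odd_parts G (W - U) P" "card U + card (W - \<Union>M) \<le> card P"
    using tutte_berge[OF assms(1,2) M] by blast
  with assms(3)[of U P] have "card (W - \<Union>M) = 0" by linarith
  with M assms(1) that show ?thesis by (auto simp: max_matching_def matching_def)
qed

section \<open>Trails, closed walks and Euler families\<close>

text \<open>Each step stores both of its end vertices, so that reversing a trail is easy; a closed
  walk stores just the first vertex of each step. How often an edge is used is tracked separately
  through multisets.\<close>

fun trail :: "('e \<Rightarrow> 'v set) \<Rightarrow> 'v \<Rightarrow> ('v \<times> 'e \<times> 'v) list \<Rightarrow> 'v \<Rightarrow> bool" where
  "trail inc u [] w \<longleftrightarrow> u = w"
| "trail inc u ((a, e, b) # xs) w \<longleftrightarrow>
     u = a \<and> a \<noteq> b \<and> a \<in> inc e \<and> b \<in> inc e \<and> trail inc b xs w"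

definition rev_steps :: "('v \<times> 'e \<times> 'v) list \<Rightarrow> ('v \<times> 'e \<times> 'v) list" where
  "rev_steps xs = rev (map (\<lambda>(a, e, b). (b, e, a)) xs)"

lemma trail_append: "trail inc u xs v \<Longrightarrow> trail inc v ys w \<Longrightarrow> trail inc u (xs @ ys) w"
  by (induction xs arbitrary: u) auto

lemma trail_rev: "trail inc u xs w \<Longrightarrow> trail inc w (rev_steps xs) u"
  by (induction xs arbitrary: u) (auto simp: rev_steps_def intro!: trail_append)

lemma mset_rev_steps: "mset (map (fst \<circ> snd) (rev_steps xs)) = mset (map (fst \<circ> snd) xs)"
  by (induction xs) (auto simp: rev_steps_def)

lemma trail_nth:
  assumes "trail inc u xs w" "i < length xs"
  shows "case xs ! i of (a, e, b) \<Rightarrow> a \<noteq> b \<and> a \<in> inc e \<and> b \<in> inc e \<and>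
    b = (if Suc i < length xs then fst (xs ! Suc i) else w)"
  using assms
proof (induction xs arbitrary: u i)
  case (Cons s xs)
  obtain a e b where [simp]: "s = (a, e, b)" by (cases s)
  show ?case
  proof (cases i)
    case 0
    then show ?thesis using Cons.prems by (cases xs) auto
  next
    case (Suc j)
    then show ?thesis using Cons.prems Cons.IH[of b j] by auto
  qed
qed simp

lemma closed_walk_of_trail:
  assumes "trail inc u xs u" "xs \<noteq> []" "fst ` snd ` set xs \<subseteq> E" "\<forall>e\<in>E. inc e \<subseteq> V"
  shows "closed_walk V E inc (map (\<lambda>(a, e, b). (a, e)) xs)"
  unfolding closed_walk_def
proof (intro conjI allI impI)
  fix i assume i: "i < length (map (\<lambda>(a, e, b). (a, e)) xs)"
  obtain a e b where s: "xs ! i = (a, e, b)" by (metis prod_cases3)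
  have hd: "fst (xs ! 0) = u" using assms(1,2) by (cases xs) auto
  have e: "e \<in> E" using assms(3) i s nth_mem[of i xs] by force
  have *: "fst (map (\<lambda>(a, e, b). (a, e)) xs ! j) = fst (xs ! j)" if "j < length xs" for j
    using that by (simp add: case_prod_beta)
  \<comment> \<open>At the last index the successor wraps around to index 0, whose vertex is
    \<open>u\<close>, the end of the trail.\<close>
  have b: "fst (map (\<lambda>(a, e, b). (a, e)) xs !
      ((i + 1) mod length (map (\<lambda>(a, e, b). (a, e)) xs))) = b"
  proof (cases "Suc i < length xs")
    case True
    then show ?thesis using trail_nth[OF assms(1), of i] s * by simp
  next
    case False
    then have "Suc i = length xs" using i by simp
    then show ?thesis using trail_nth[OF assms(1), of i] s *[of 0] hd assms(2) by simp
  qed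
  have t: "a \<noteq> b" "a \<in> inc e" "b \<in> inc e" using trail_nth[OF assms(1), of i] s i by auto
  show "{fst (map (\<lambda>(a, e, b). (a, e)) xs ! i), fst (map (\<lambda>(a, e, b). (a, e)) xs !
      ((i + 1) mod length (map (\<lambda>(a, e, b). (a, e)) xs)))}
        \<subseteq> inc (snd (map (\<lambda>(a, e, b). (a, e)) xs ! i))"
    unfolding b using t i s by simp
  show "fst (map (\<lambda>(a, e, b). (a, e)) xs ! i) \<noteq> fst (map (\<lambda>(a, e, b). (a, e)) xs !
      ((i + 1) mod length (map (\<lambda>(a, e, b). (a, e)) xs)))"
    unfolding b using t i s by simp
  show "fst (map (\<lambda>(a, e, b). (a, e)) xs ! i) \<in> V" "snd (map (\<lambda>(a, e, b). (a, e)) xs ! i) \<in> E"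
    using t i s e assms(4) by auto
qed (use assms in simp)

text \<open>Trails carry their end points; the induction joins an open trail at its last vertex with
  another trail ending there, which exists by parity.\<close>
lemma join_trails:
  fixes Ts :: "('v \<times> ('v \<times> 'e \<times> 'v) list \<times> 'v) list"
  assumes "\<forall>(u, xs, w) \<in> set Ts. trail inc u xs w \<and> xs \<noteq> []"
    and "\<And>v. even (\<Sum>(u, xs, w)\<leftarrow>Ts. of_bool (u = v) + of_bool (w = v) :: nat)"
  shows "\<exists>Ws. (\<forall>xs\<in>set Ws. xs \<noteq> [] \<and> (\<exists>u. trail inc u xs u)) \<and>
    mset (map (fst \<circ> snd) (concat Ws)) = mset (map (fst \<circ> snd) (concat (map (fst \<circ> snd) Ts)))"
  using assms
proof (induction "length Ts" arbitrary: Ts rule: less_induct)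
  case less
  show ?case
  proof (cases "\<forall>(u, xs, w)\<in>set Ts. u = w")
    case True
    then show ?thesis using less.prems(1)
      by (intro exI[of _ "map (fst \<circ> snd) Ts"]) fastforce
  next
    case False
    then obtain u xs w where p: "(u, xs, w) \<in> set Ts" "u \<noteq> w" by blast
    then obtain A B where AB: "Ts = A @ (u, xs, w) # B" by (meson split_list)
    \<comment> \<open>Otherwise \<open>w\<close> would be an end of this one trail only, and just
      once since \<open>u \<noteq> w\<close>, so its count would be 1.\<close>
    have "\<exists>(u', ys, w') \<in> set (A @ B). u' = w \<or> w' = w"
    proof (rule ccontr)
      assume "\<not> ?thesis"
      then have "(\<Sum>(u', ys, w')\<leftarrow>A. of_bool (u' = w) + of_bool (w' = w) :: nat) = 0"
        "(\<Sum>(u', ys, w')\<leftarrow>B. of_bool (u' = w) + of_bool (w' = w) :: nat) = 0"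
        by (fastforce simp: sum_list_eq_0_iff)+
      then show False using less.prems(2)[of w] p(2) by (simp add: AB del: sum_list_eq_0_iff)
    qed
    then obtain u' ys w' where q: "(u', ys, w') \<in> set (A @ B)" "u' = w \<or> w' = w" by blast
    from split_list[OF q(1)] obtain C D where CD: "A @ B = C @ (u', ys, w') # D" by blast
    have mTs: "mset Ts = {#(u, xs, w), (u', ys, w')#} + mset C + mset D"
    proof -
      have "mset Ts = add_mset (u, xs, w) (mset (A @ B))" by (simp add: AB)
      then show ?thesis unfolding CD by simp
    qed
    have sTs: "set Ts = {(u, xs, w), (u', ys, w')} \<union> set C \<union> set D"
      using arg_cong[OF mTs, of set_mset] by simp
    have tx: "trail inc u xs w" "xs \<noteq> []" "trail inc u' ys w'" "ys \<noteq> []"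
      using less.prems(1) sTs by auto
    define zs where "zs = (if u' = w then ys else rev_steps ys)"
    define z where "z = (if u' = w then w' else u')"
    have tz: "trail inc w zs z" "zs \<noteq> []"
      using q(2) tx by (auto simp: zs_def z_def trail_rev) (simp add: rev_steps_def)
    have mz: "mset (map (fst \<circ> snd) zs) = mset (map (fst \<circ> snd) ys)"
      using mset_rev_steps[of ys] by (simp add: zs_def)
    let ?Ts = "(u, xs @ zs, z) # C @ D"
    have "length ?Ts < length Ts" using arg_cong[OF mTs, of size] by simp
    moreover have "\<forall>(u, xs, w) \<in> set ?Ts. trail inc u xs w \<and> xs \<noteq> []"
      using less.prems(1) sTs trail_append[OF tx(1) tz(1)] tx(2) by auto
    moreover have "even (\<Sum>(u, xs, w)\<leftarrow>?Ts. of_bool (u = v) + of_bool (w = v) :: nat)" for v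
    proof -
      have "(\<Sum>(u, xs, w)\<leftarrow>Ts. of_bool (u = v) + of_bool (w = v) :: nat)
        = (\<Sum>(u, xs, w)\<in>#mset Ts. of_bool (u = v) + of_bool (w = v))"
        by (simp flip: sum_mset_sum_list)
      \<comment> \<open>Joining removes two trail ends, both at \<open>w\<close>, so no parity
        changes.\<close>
      also have "\<dots> = (\<Sum>(u, xs, w)\<leftarrow>?Ts. of_bool (u = v) + of_bool (w = v)) + 2 * of_bool (w = v)"
        unfolding mTs using q(2) by (auto simp: z_def simp flip: sum_mset_sum_list)
      finally show ?thesis using less.prems(2)[of v] by simp
    qed
    moreover have m: "mset (map (fst \<circ> snd) (concat (map (fst \<circ> snd) ?Ts)))
        = mset (map (fst \<circ> snd) (concat (map (fst \<circ> snd) Ts)))"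
    proof -
      have e: "mset (map (fst \<circ> snd) (concat (map (fst \<circ> snd) Us)))
        = (\<Sum>x\<in>#mset Us. mset (map (fst \<circ> snd) (fst (snd x))))"
        for Us :: "('v \<times> ('v \<times> 'e \<times> 'v) list \<times> 'v) list"
        by (induction Us) auto
      show ?thesis unfolding e mTs using mz by simp
    qed
    ultimately show ?thesis using less.hyps[of ?Ts] unfolding m by blast
  qed
qed

text \<open>Each edge starts as a one-step trail between its two vertices in \<open>F\<close>. The
  number of trail ends at \<open>v\<close> is then its degree in \<open>F\<close>, so
  \<open>join_trails\<close> turns these trails into closed ones with the same multiset of
  edges.\<close>

lemma quasi_eulerian_of_even_subgraph:
  assumes hyp: "hypergraph V E inc" and F: "F \<subseteq> flags E inc"
    and deg2: "\<And>e. e \<in> E \<Longrightarrow> card {v. (v, e) \<in> F} = 2"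
    and even: "\<And>v. even (card {e. (v, e) \<in> F})"
  shows "quasi_eulerian V E inc"
proof -
  have finE: "finite E" and incV: "\<forall>e\<in>E. inc e \<subseteq> V" using hyp by (auto simp: hypergraph_def)
  have "\<forall>e\<in>E. \<exists>a b. {v. (v, e) \<in> F} = {a, b} \<and> a \<noteq> b"
    using deg2 by (meson card_2_iff)
  then obtain a b where ab: "\<And>e. e \<in> E \<Longrightarrow> {v. (v, e) \<in> F} = {a e, b e} \<and> a e \<noteq> b e"
    by metis
  obtain es where es: "set es = E" "distinct es" using finite_distinct_list[OF finE] by blast
  let ?Ts = "map (\<lambda>e. (a e, [(a e, e, b e)], b e)) es"
  have "\<forall>(u, xs, w) \<in> set ?Ts. trail inc u xs w \<and> xs \<noteq> []"
    using ab F es(1) by (fastforce simp: flags_def)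
  moreover have "even (\<Sum>(u, xs, w)\<leftarrow>?Ts. of_bool (u = v) + of_bool (w = v) :: nat)" for v
  proof -
    have "(\<Sum>(u, xs, w)\<leftarrow>?Ts. of_bool (u = v) + of_bool (w = v) :: nat)
      = (\<Sum>e\<in>E. of_bool (a e = v) + of_bool (b e = v))"
      using es by (simp add: comp_def sum_list_distinct_conv_sum_set)
    also have "\<dots> = (\<Sum>e\<in>E. of_bool ((v, e) \<in> F))"
    proof (rule sum.cong)
      fix e assume "e \<in> E"
      then show "(of_bool (a e = v) + of_bool (b e = v) :: nat) = of_bool ((v, e) \<in> F)"
        using ab[of e] by (auto simp: set_eq_iff)
    qed simp
    also have "\<dots> = card {e. (v, e) \<in> F}"
      using F finE by (auto simp: flags_def Collect_conj_eq Int_absorb1 of_bool_def sum.If_cases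
          intro!: arg_cong[of _ _ card])
    finally show ?thesis using even by simp
  qed
  ultimately obtain Ws where Ws: "\<forall>xs\<in>set Ws. xs \<noteq> [] \<and> (\<exists>u. trail inc u xs u)"
    "mset (map (fst \<circ> snd) (concat Ws)) = mset (map (fst \<circ> snd) (concat (map (fst \<circ> snd) ?Ts)))"
    using join_trails[of ?Ts inc] by blast
  have "map (fst \<circ> snd) (concat (map (fst \<circ> snd) ?Ts)) = es" by (induction es) auto
  with Ws(2) have mes: "mset (map (fst \<circ> snd) (concat Ws)) = mset es" by (simp only:)
  let ?Vs = "map (map (\<lambda>(a, e, b). (a, e))) Ws"
  have "map snd (concat ?Vs) = map (fst \<circ> snd) (concat Ws)"
    by (induction Ws) auto
  then have 1: "count_list (map snd (concat ?Vs)) e = 1" if "e \<in> E" for e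
    using mes that es by (metis count_mset distinct_count_atmost_1)
  have 2: "closed_walk V E inc W" if "W \<in> set ?Vs" for W
  proof -
    from that obtain xs where xs: "xs \<in> set Ws" "W = map (\<lambda>(a, e, b). (a, e)) xs" by auto
    have E: "set (map (fst \<circ> snd) (concat Ws)) = E" using arg_cong[OF mes, of set_mset] es by simp
    have "fst ` snd ` set xs \<subseteq> E" using xs(1) unfolding E[symmetric] by (auto simp: image_image)
    moreover obtain u where "trail inc u xs u" "xs \<noteq> []" using Ws(1) xs(1) by blast
    ultimately show ?thesis unfolding xs(2) using incV by (intro closed_walk_of_trail)
  qed
  show ?thesis unfolding quasi_eulerian_def euler_family_def using 1 2 by (intro exI[of _ ?Vs]) blast
qed

section \<open>The gadget graph and its perfect matchings\<close>

text \<open>The vertices Inl (v, e) are the flags; the vertices Inr (e, i) are dummies that absorb all but two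
  of the flags at e, so that the remaining flags are matched with each other at their vertices.\<close>
definition gadget_vertices :: "'e set \<Rightarrow> ('e \<Rightarrow> 'v set) \<Rightarrow> ('v \<times> 'e + 'e \<times> nat) set" where
  "gadget_vertices E inc =
     Inl ` flags E inc \<union> {Inr (e, i) | e i. e \<in> E \<and> i < card (inc e) - 2}"

text \<open>One graph serves all hypergraphs: the incidences enter through
  \<open>gadget_vertices\<close>, in which matchings must stay. There the flags at a vertex form a
  clique, and the flags and dummies of an edge form a complete bipartite graph.\<close>

definition gadget_edges :: "('v \<times> 'e + 'e \<times> nat) set set" where
  "gadget_edges = {{Inl (v, e), Inr (e, i)} | v e i. True} \<union>
     {{Inl (v, e), Inl (v, e')} | v e e'. e \<noteq> e'}"

lemma card_gadget_edges: "\<forall>h\<in>gadget_edges. card h = 2"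
  by (auto simp: gadget_edges_def card_insert_if)

lemma gadget_edges_core:
  "{Inl (v, e), Inr (e', i)} \<in> gadget_edges \<longleftrightarrow> e = e'"
  "{Inr (e', i), Inl (v, e)} \<in> gadget_edges \<longleftrightarrow> e = e'"
  by (auto simp: gadget_edges_def doubleton_eq_iff)

lemma gadget_edges_flags:
  "{Inl (v, e), Inl (v', e')} \<in> gadget_edges \<longleftrightarrow> v = v' \<and> e \<noteq> e'"
  by (auto simp: gadget_edges_def doubleton_eq_iff)

lemma gadget_edges_cores: "{Inr x, Inr y} \<notin> gadget_edges"
  by (auto simp: gadget_edges_def doubleton_eq_iff)

text \<open>The flags that are not matched to dummies form the required even subgraph: the dummies
  of an edge use up all but two of its flags, and the remaining flags are matched in pairs that
  share a vertex.\<close>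

lemma quasi_eulerian_of_gadget_matching:
  fixes inc :: "'e \<Rightarrow> 'v set"
  assumes hyp: "hypergraph V E inc" and ge2: "\<forall>e\<in>E. card (inc e) \<ge> 2"
    and M: "matching gadget_edges (gadget_vertices E inc) M" and UM: "\<Union>M = gadget_vertices E inc"
  shows "quasi_eulerian V E inc"
proof -
  let ?W = "gadget_vertices E inc"
  define F where "F = {(v, e) \<in> flags E inc. \<forall>i. {Inl (v, e), Inr (e, i)} \<notin> M}"
  have fin: "finite E" "\<And>e. e \<in> E \<Longrightarrow> finite (inc e)"
    using hyp unfolding hypergraph_def by (auto intro: finite_subset)
  have MG: "M \<subseteq> gadget_edges" using M by (simp add: matching_def)
  have deg2: "card {v. (v, e) \<in> F} = 2" if e: "e \<in> E" for e
  proof -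
    have "\<exists>v. {Inl (v, e), Inr (e, i)} \<in> M" if "i < card (inc e) - 2" for i
    proof -
      have "Inr (e, i) \<in> \<Union>M" using that e by (auto simp: UM gadget_vertices_def)
      from matching_edge[OF card_gadget_edges M this]
      obtain z where z: "{Inr (e, i), z} \<in> M" by blast
      then have "{Inr (e, i), z} \<in> gadget_edges" using MG by blast
      then obtain v where "z = Inl (v, e)"
        by (cases z) (auto simp: gadget_edges_core gadget_edges_cores)
      then show ?thesis using z by (auto simp: insert_commute)
    qed
    \<comment> \<open>\<open>g i\<close> gives the flag that dummy \<open>i\<close> absorbs;
      \<open>g\<close> turns out to be a bijection from the dummies of \<open>e\<close> onto the
      flags of \<open>e\<close> outside \<open>F\<close>.\<close>
    then obtain g where g: "\<And>i. i < card (inc e) - 2 \<Longrightarrow> {Inl (g i, e), Inr (e, i)} \<in> M"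
      by metis
    have "inj_on g {..<card (inc e) - 2}"
    proof (rule inj_onI)
      fix i j assume ij: "i \<in> {..<card (inc e) - 2}" "j \<in> {..<card (inc e) - 2}" "g i = g j"
      then have "{Inl (g i, e), Inr (e, i)} = {Inl (g j, e), Inr (e, j)}"
        using g[of i] g[of j] by (intro matching_unique[OF M, of _ _ "Inl (g i, e)"]) simp_all
      then show "i = j" by (auto simp: doubleton_eq_iff)
    qed
    moreover have "g ` {..<card (inc e) - 2} = inc e - {v. (v, e) \<in> F}"
    proof (intro equalityI subsetI)
      fix v assume "v \<in> g ` {..<card (inc e) - 2}"
      then obtain i where i: "i < card (inc e) - 2" "v = g i" by blast
      then have "Inl (v, e) \<in> ?W" using g[OF i(1)] by (auto simp flip: UM)
      then show "v \<in> inc e - {v. (v, e) \<in> F}"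
        using g[OF i(1)] i(2) by (auto simp: gadget_vertices_def F_def flags_def)
    next
      fix v assume v: "v \<in> inc e - {v. (v, e) \<in> F}"
      then obtain i where i: "{Inl (v, e), Inr (e, i)} \<in> M"
        using e by (auto simp: F_def flags_def)
      then have "Inr (e, i) \<in> ?W" by (auto simp flip: UM)
      then have i': "i < card (inc e) - 2" by (auto simp: gadget_vertices_def)
      have "{Inl (v, e), Inr (e, i)} = {Inl (g i, e), Inr (e, i)}"
        using i g[OF i'] by (intro matching_unique[OF M, of _ _ "Inr (e, i)"]) auto
      then show "v \<in> g ` {..<card (inc e) - 2}" using i' by (auto simp: doubleton_eq_iff)
    qed
    ultimately have "card (inc e - {v. (v, e) \<in> F}) = card (inc e) - 2"
      by (metis card_image card_lessThan)
    moreover have sub: "{v. (v, e) \<in> F} \<subseteq> inc e" by (auto simp: F_def flags_def)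
    moreover have "card {v. (v, e) \<in> F} \<le> card (inc e)" using sub fin(2)[OF e] by (rule card_mono[rotated])
    ultimately show ?thesis
      using ge2 e fin(2)[OF e] by (auto simp: card_Diff_subset finite_subset)
  qed
  have even: "even (card {e. (v, e) \<in> F})" for v
  proof -
    \<comment> \<open>The matching edges between two flags at \<open>v\<close> cover exactly the
      flags of \<open>F\<close> at \<open>v\<close>, so these are even in number.\<close>
    let ?M = "{h \<in> M. h \<subseteq> range (\<lambda>e. Inl (v, e))}"
    have "(\<lambda>e. Inl (v, e)) ` {e. (v, e) \<in> F} = \<Union>?M"
    proof (intro equalityI subsetI)
      fix z :: "'v \<times> 'e + 'e \<times> nat" assume "z \<in> (\<lambda>e. Inl (v, e)) ` {e. (v, e) \<in> F}"
      then obtain e where e: "z = Inl (v, e)" "(v, e) \<in> F" by blast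
      then have "z \<in> \<Union>M" unfolding UM by (auto simp: F_def gadget_vertices_def)
      from matching_edge[OF card_gadget_edges M this] obtain y where y: "{z, y} \<in> M" by blast
      then have "{z, y} \<in> gadget_edges" using MG by blast
      then have "y \<in> range (\<lambda>e. Inl (v, e))" using e y
        by (cases y) (auto simp: gadget_edges_core gadget_edges_flags F_def)
      then show "z \<in> \<Union>?M" using y e by blast
    next
      fix z :: "'v \<times> 'e + 'e \<times> nat" assume "z \<in> \<Union>?M"
      then obtain h e where h: "h \<in> M" "h \<subseteq> range (\<lambda>e. Inl (v, e))" "z \<in> h" "z = Inl (v, e)" by blast
      then have "z \<in> ?W" by (auto simp flip: UM)
      then have "(v, e) \<in> flags E inc" using h(4) by (auto simp: gadget_vertices_def)
      moreover have "{Inl (v, e), Inr (e, i)} \<notin> M" for i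
        using matching_unique[OF M h(1), of "{Inl (v, e), Inr (e, i)}" z] h by auto
      ultimately show "z \<in> (\<lambda>e. Inl (v, e)) ` {e. (v, e) \<in> F}" using h(4) by (auto simp: F_def)
    qed
    moreover have "finite ?W" using finite_subset[of "flags E inc" "(\<Union>e\<in>E. inc e) \<times> E"] fin
      finite_subset[of "{Inr (e, i) | e i. e \<in> E \<and> i < card (inc e) - 2}"
        "Inr ` (SIGMA e:E. {..<card (inc e) - 2})"]
      by (auto simp: gadget_vertices_def flags_def)
    then have "even (card (\<Union>?M))"
      using card_Union_matching[OF _ card_gadget_edges matching_subset[OF M, of ?M]] by simp
    moreover have "card ((\<lambda>e. Inl (v, e) :: 'v \<times> 'e + 'e \<times> nat) ` {e. (v, e) \<in> F}) = card {e. (v, e) \<in> F}"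
      by (rule card_image) (auto intro: inj_onI)
    ultimately show ?thesis by (simp only:)
  qed
  show ?thesis
    by (rule quasi_eulerian_of_even_subgraph[OF hyp _ deg2 even]) (auto simp: F_def)
qed

section \<open>Cuts of the incidence graph and sums of charges\<close>

text \<open>Once all crossing flags are deleted, no path changes sides. If they were fewer than
  \<open>l\<close>, the graph would stay connected, although the given flag has its ends on
  different sides.\<close>

lemma incidence_cut:
  assumes hyp: "hypergraph V E inc" and conn: "incidence_edge_connected l V E inc"
    and f: "(v, e) \<in> flags E inc" "(v \<in> X) \<noteq> (e \<in> Y)"
  shows "l \<le> card {(v, e) \<in> flags E inc. (v \<in> X) \<noteq> (e \<in> Y)}"
proof (rule ccontr)
  let ?S = "{(v, e) \<in> flags E inc. (v \<in> X) \<noteq> (e \<in> Y)}"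
  assume "\<not> ?thesis"
  then have "card ?S < l" by (rule not_le_imp_less)
  moreover have "?S \<subseteq> flags E inc" by blast
  ultimately have "inc_connected V E (flags E inc - ?S)"
    using conn unfolding incidence_edge_connected_def by blast
  then have "(Inl v, Inr e) \<in> (inc_adj (flags E inc - ?S))\<^sup>*"
    using f(1) hyp unfolding inc_connected_def flags_def hypergraph_def by blast
  moreover have "(case z of Inl v \<Rightarrow> v \<in> X | Inr e \<Rightarrow> e \<in> Y) = (v \<in> X)"
    if "(Inl v, z) \<in> (inc_adj (flags E inc - ?S))\<^sup>*" for z
    using that by (induction rule: rtrancl_induct) (auto simp: inc_adj_def)
  ultimately show False using f(2) by fastforce
qed

text \<open>For \<open>a = 1\<close>, at least \<open>k / c\<close> is left for \<open>b\<close>,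
  and \<open>2 / k * (k / c) = 2 / c\<close> fills up \<open>1 - 2 / c\<close>. The next odd value
  is 3, and \<open>3 * (1 - 2 / c) \<ge> 1\<close> because \<open>c \<ge> 3\<close>.\<close>

lemma charge_ge_1:
  fixes a b c k :: nat
  assumes "c \<ge> 3" "k \<ge> c" "odd a" "1 + nat \<lceil>real k / real c\<rceil> \<le> a + b"
  shows "1 \<le> (1 - 2 / real c) * real a + 2 / real k * real b"
proof (cases "a = 1")
  case True
  then have "real k / real c \<le> real b" using assms(4) by linarith
  then have "2 / real k * (real k / real c) \<le> 2 / real k * real b" by (intro mult_left_mono) auto
  then show ?thesis using True assms(1,2) by simp
next
  case False
  then have "3 \<le> a" using assms(3) by (cases a rule: nat.exhaust) (auto elim: oddE)
  then have "(1 - 2 / 3) * (3::real) \<le> (1 - 2 / real c) * real a"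
    using assms(1) by (intro mult_mono diff_left_mono divide_left_mono) auto
  then have "1 \<le> (1 - 2 / real c) * real a" by simp
  then show ?thesis by (intro add_increasing2) simp_all
qed

lemma sum_flags:
  assumes "finite E" "\<forall>e\<in>E. finite (inc e)" "Y \<subseteq> E"
  shows "(\<Sum>(v, e)\<in>{(v, e) \<in> flags E inc. e \<in> Y \<and> R v e}. g v e) =
    (\<Sum>e\<in>Y. \<Sum>v\<in>{v \<in> inc e. R v e}. g v e)"
proof -
  have "(\<Sum>e\<in>Y. \<Sum>v\<in>{v \<in> inc e. R v e}. g v e) =
    (\<Sum>(e, v)\<in>(SIGMA e:Y. {v \<in> inc e. R v e}). g v e)"
    using assms by (intro sum.Sigma) (auto intro: finite_subset)
  also have "\<dots> = (\<Sum>(v, e)\<in>{(v, e) \<in> flags E inc. e \<in> Y \<and> R v e}. g v e)"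
    by (rule sum.reindex_bij_witness[of _ prod.swap prod.swap])
      (use assms(3) in \<open>auto simp: flags_def\<close>)
  finally show ?thesis by simp
qed

lemma card_flags:
  assumes "finite E" "\<forall>e\<in>E. finite (inc e)" "Y \<subseteq> E"
  shows "card {(v, e) \<in> flags E inc. e \<in> Y \<and> R v e} = (\<Sum>e\<in>Y. card {v \<in> inc e. R v e})"
  using sum_flags[OF assms, where R = R and g = "\<lambda>_ _. 1::nat"] by (simp only: card_eq_sum case_prod_unfold)

text \<open>Bounds the charge received by all parts together by the charge available, each source
  serving at most one part.\<close>

lemma sum_disjoint_family_le:
  fixes g :: "'a \<Rightarrow> real"
  assumes "finite Y" "\<And>y. y \<in> Y \<Longrightarrow> 0 \<le> g y" "finite P"
    and "\<And>D. D \<in> P \<Longrightarrow> X D \<subseteq> Y"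
    and "\<And>D D' x. D \<in> P \<Longrightarrow> D' \<in> P \<Longrightarrow> x \<in> X D \<Longrightarrow> x \<in> X D' \<Longrightarrow> D = D'"
  shows "(\<Sum>D\<in>P. sum g (X D)) \<le> sum g Y"
proof -
  have "(\<Sum>D\<in>P. sum g (X D)) = sum g (\<Union>D\<in>P. X D)"
    by (rule sum.UNION_disjoint[symmetric]) (use assms in \<open>auto intro: finite_subset\<close>)
  also have "\<dots> \<le> sum g Y" using assms by (intro sum_mono2) auto
  finally show ?thesis .
qed

section \<open>The barrier inequality for the gadget graph\<close>

lemma gadget_barrier:
  fixes inc :: "'e \<Rightarrow> 'v set"
  assumes hyp: "hypergraph V E inc"
    and card_inc: "\<And>e. e \<in> E \<Longrightarrow> c \<le> card (inc e)" "\<And>e. e \<in> E \<Longrightarrow> card (inc e) \<le> k"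
    and c: "3 \<le> c" "c \<le> k"
    and conn: "incidence_edge_connected (1 + nat \<lceil>real k / real c\<rceil>) V E inc"
    and S: "S \<subseteq> gadget_vertices E inc"
    and P: "odd_parts gadget_edges (gadget_vertices E inc - S) P"
  shows "card P \<le> card S"
proof -
  let ?W = "gadget_vertices E inc"
  define d where "d e = card (inc e)" for e
  define x where "x e = card {i. i < d e - 2 \<and> Inr (e, i) \<in> S}" for e
  define y where "y e = card {v \<in> inc e. Inl (v, e) \<in> S}" for e
  \<comment> \<open>\<open>A\<close>, \<open>B\<close> and \<open>N\<close> sort the edges by what
    survives outside \<open>S\<close>: no dummy; some dummy but no flag, so that the dummies left
    are isolated; both a dummy and a flag.\<close>
  define A where "A e \<longleftrightarrow> (\<forall>i < d e - 2. Inr (e, i) \<in> S)" for e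
  define B where "B e \<longleftrightarrow> \<not> A e \<and> (\<forall>v \<in> inc e. Inl (v, e) \<in> S)" for e
  define N where "N e \<longleftrightarrow> e \<in> E \<and> \<not> A e \<and> \<not> B e" for e
  \<comment> \<open>\<open>p v e\<close> is what reaches \<open>v\<close> through the flag,
    \<open>Q e\<close> is what \<open>e\<close> keeps, and \<open>ZZ\<close> collects the isolated
    dummies, each counting 1 for itself.\<close>
  define p :: "'v \<Rightarrow> 'e \<Rightarrow> real" where
    "p v e = (if Inl (v, e) \<in> S then 2 / k else if A e then 1 - 2 / c else 0)" for v e
  define Q :: "'e \<Rightarrow> real" where "Q e = x e + (1 - 2 / k) * y e" for e
  define ZZ where "ZZ = {Inr (e, i) :: 'v \<times> 'e + 'e \<times> nat | e i. e \<in> E \<and> B e \<and> i < d e - 2 \<and> Inr (e, i) \<notin> S}"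
  \<comment> \<open>\<open>X D\<close> and \<open>Y D\<close> are the trace of a part on the
    incidence graph. Only edges of type \<open>N\<close> are taken: their flags and dummies outside
    \<open>S\<close> are connected and so fall into a single part.\<close>
  define X where "X D = {v. \<exists>e. Inl (v, e) \<in> D}" for D :: "('v \<times> 'e + 'e \<times> nat) set"
  define Y where "Y D = {e. N e \<and> (\<exists>i. Inr (e, i) \<in> D)}" for D :: "('v \<times> 'e + 'e \<times> nat) set"
  define FX where "FX D = {(v, e) \<in> flags E inc. v \<in> X D}" for D
  define ch where "ch D = (\<Sum>(v, e)\<in>FX D. p v e) + (\<Sum>e\<in>Y D. Q e) + (\<Sum>z\<in>ZZ \<inter> D. 1)" for D

  have fin: "finite E" "\<forall>e\<in>E. finite (inc e)"
    using hyp unfolding hypergraph_def by (auto intro: finite_subset)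
  have finF: "finite (flags E inc)"
    using finite_subset[of "flags E inc" "(\<Union>e\<in>E. inc e) \<times> E"] fin by (auto simp: flags_def)
  have finC: "finite (Inr ` (SIGMA e:E. {..<d e - 2}) :: ('v \<times> 'e + 'e \<times> nat) set)"
    using fin by auto
  have W_eq: "?W = Inl ` flags E inc \<union> Inr ` (SIGMA e:E. {..<d e - 2})"
    by (auto simp: gadget_vertices_def d_def)
  then have finW: "finite ?W" using finF finC by simp
  have Inl_W: "Inl (v, e) \<in> ?W \<longleftrightarrow> e \<in> E \<and> v \<in> inc e" for v e
    by (auto simp: W_eq flags_def)
  have Inr_W: "Inr (e, i) \<in> ?W \<longleftrightarrow> e \<in> E \<and> i < d e - 2" for e i
    by (auto simp: W_eq)
  have finZ: "finite ZZ" by (rule finite_subset[OF _ finC]) (auto simp: ZZ_def)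
  have p0: "0 \<le> p v e" for v e using c by (auto simp: p_def field_simps)
  have k2: "0 \<le> 1 - 2 / real k" using c by (auto simp: field_simps)
  have Q0: "0 \<le> Q e" for e using k2 by (simp add: Q_def)
  have finP: "finite P" using P finW unfolding odd_parts_def
    by (intro finite_subset[of P "Pow ?W"]) auto
  have dsub: "D \<subseteq> ?W - S" if "D \<in> P" for D using P that by (simp add: odd_parts_def)
  have dodd: "odd (card D)" if "D \<in> P" for D using P that by (simp add: odd_parts_def)
  have closed: "w \<in> D" if "D \<in> P" "z \<in> D" "w \<in> ?W" "w \<notin> S" "{z, w} \<in> gadget_edges" for D z w
    using P that unfolding odd_parts_def by blast
  have disj: "D = D'" if "D \<in> P" "D' \<in> P" "z \<in> D" "z \<in> D'" for D D' z
    using P that unfolding odd_parts_def pairwise_def disjnt_def by blast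
  \<comment> \<open>The flags at a vertex are mutually adjacent, so those outside \<open>S\<close>
    never lie in two different parts.\<close>
  have flag_flag: "Inl (v, e') \<in> D"
    if "D \<in> P" "Inl (v, e) \<in> D" "e' \<in> E" "v \<in> inc e'" "Inl (v, e') \<notin> S" for D v e e'
    using closed[OF that(1,2), of "Inl (v, e')"] that
    by (cases "e = e'") (auto simp: Inl_W gadget_edges_flags)
  have core_flag: "Inl (v, e) \<in> D"
    if "D \<in> P" "Inr (e, i) \<in> D" "v \<in> inc e" "Inl (v, e) \<notin> S" for D v e i
    using closed[OF that(1,2), of "Inl (v, e)"] that dsub[OF that(1)] Inr_W[of e i]
    by (auto simp: Inl_W gadget_edges_core)
  have flag_core: "Inr (e, i) \<in> D"
    if "D \<in> P" "Inl (v, e) \<in> D" "i < d e - 2" "Inr (e, i) \<notin> S" for D v e i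
    using closed[OF that(1,2), of "Inr (e, i)"] that dsub[OF that(1)] Inl_W[of v e]
    by (auto simp: Inr_W gadget_edges_core)
  have N_flag: "\<exists>v\<in>inc e. Inl (v, e) \<notin> S" if "N e" for e
    using that by (auto simp: N_def B_def)

  have ch_ge: "1 \<le> ch D" if D: "D \<in> P" for D
  proof -
    have finFX: "finite (FX D)" using finF by (rule finite_subset[rotated]) (auto simp: FX_def)
    have finY: "finite (Y D)" using fin(1) by (rule finite_subset[rotated]) (auto simp: Y_def N_def)
    have YE: "Y D \<subseteq> E" by (auto simp: Y_def N_def)
    have s1: "0 \<le> (\<Sum>(v, e)\<in>FX D. p v e)" by (intro sum_nonneg) (auto simp: p0)
    have s2: "0 \<le> (\<Sum>e\<in>Y D. Q e)" by (intro sum_nonneg) (auto simp: Q0)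
    have s3: "(0::real) \<le> (\<Sum>z\<in>ZZ \<inter> D. 1)" by simp
    \<comment> \<open>Three easy ways to reach 1: an isolated dummy; a dummy in \<open>S\<close> at
      an edge of \<open>Y D\<close>; a flag in \<open>S\<close> between \<open>X D\<close> and
      \<open>Y D\<close>, giving \<open>2 / k\<close> through its vertex and
      \<open>1 - 2 / k\<close> through its edge. In the fourth case \<open>D\<close> is determined
      by \<open>X D\<close> and \<open>Y D\<close>, and connectivity comes in.\<close>
    consider "ZZ \<inter> D \<noteq> {}"
      | e where "e \<in> Y D" "x e \<noteq> 0"
      | v e where "v \<in> X D" "e \<in> Y D" "v \<in> inc e" "Inl (v, e) \<in> S"
      | "ZZ \<inter> D = {}" "\<forall>e\<in>Y D. x e = 0" "\<forall>v\<in>X D. \<forall>e\<in>Y D. v \<in> inc e \<longrightarrow> Inl (v, e) \<notin> S"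
      by blast
    then show ?thesis
    proof cases
      case 1
      then have "0 < card (ZZ \<inter> D)" using finZ by (simp add: card_gt_0_iff)
      then have "(1::real) \<le> (\<Sum>z\<in>ZZ \<inter> D. 1)" by simp
      then show ?thesis using s1 s2 unfolding ch_def by linarith
    next
      case 2
      have "0 \<le> (1 - 2 / real k) * y e" using k2 by simp
      then have "1 \<le> Q e" using 2(2) unfolding Q_def by linarith
      also have "\<dots> \<le> (\<Sum>e\<in>Y D. Q e)" using 2(1) finY Q0 by (intro member_le_sum) auto
      finally show ?thesis using s1 s3 unfolding ch_def by linarith
    next
      case 3
      have "e \<in> E" using 3(2) YE by blast
      then have "0 < y e" using 3(3,4) fin unfolding y_def by (auto simp: card_gt_0_iff)
      then have "(1 - 2 / real k) * 1 \<le> (1 - 2 / real k) * y e" using k2 by (intro mult_left_mono) auto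
      then have "1 - 2 / real k \<le> Q e" unfolding Q_def by simp
      also have "\<dots> \<le> (\<Sum>e\<in>Y D. Q e)" using 3(2) finY Q0 by (intro member_le_sum) auto
      finally have q: "1 - 2 / real k \<le> (\<Sum>e\<in>Y D. Q e)" .
      have "(v, e) \<in> FX D" using 3 \<open>e \<in> E\<close> by (auto simp: FX_def flags_def)
      then have "(case (v, e) of (v, e) \<Rightarrow> p v e) \<le> (\<Sum>(v, e)\<in>FX D. p v e)"
        using finFX p0 by (intro member_le_sum) auto
      then have "2 / real k \<le> (\<Sum>(v, e)\<in>FX D. p v e)" using 3(4) by (simp add: p_def)
      then show ?thesis using q s3 unfolding ch_def by linarith
    next
      case 4
      have x0: "Inr (e, i) \<notin> S" if "e \<in> Y D" "i < d e - 2" for e i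
        using 4(2) that by (auto simp: x_def)
      have flag_D: "Inl (v, e) \<in> D \<longleftrightarrow> e \<in> E \<and> v \<in> inc e \<and> v \<in> X D \<and> Inl (v, e) \<notin> S" for v e
        using dsub[OF D] Inl_W[of v e] flag_flag[OF D] by (auto simp: X_def)
      have core_D: "Inr (e, i) \<in> D \<longleftrightarrow> e \<in> Y D \<and> i < d e - 2" for e i
      proof
        assume i: "Inr (e, i) \<in> D"
        then have "e \<in> E" "i < d e - 2" "Inr (e, i) \<notin> S" using dsub[OF D] Inr_W by auto
        moreover from this have "\<not> A e" "\<not> B e" using 4(1) i by (auto simp: A_def ZZ_def)
        ultimately show "e \<in> Y D \<and> i < d e - 2" using i by (auto simp: Y_def N_def)
      next
        assume i: "e \<in> Y D \<and> i < d e - 2"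
        \<comment> \<open>A dummy of \<open>e\<close> in \<open>D\<close> leads to a flag outside
          \<open>S\<close>, and this flag to all other dummies of \<open>e\<close>, none of which is
          in \<open>S\<close> here.\<close>
        then obtain j where j: "Inr (e, j) \<in> D" "N e" by (auto simp: Y_def)
        then obtain v where "v \<in> inc e" "Inl (v, e) \<notin> S" using N_flag by blast
        then have "Inl (v, e) \<in> D" using core_flag[OF D j(1)] by blast
        then show "Inr (e, i) \<in> D" using flag_core[OF D] i x0 by blast
      qed
      \<comment> \<open>\<open>FI\<close> runs inside the trace; the other three make up the cut
        around it. \<open>FH\<close> leaves from edges of \<open>Y D\<close>, \<open>FA\<close> and
        \<open>FB\<close> from vertices of \<open>X D\<close>, outside and inside \<open>S\<close>
        respectively.\<close>
      define FI where "FI = {(v, e) \<in> flags E inc. e \<in> Y D \<and> v \<in> X D}"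
      define FH where "FH = {(v, e) \<in> flags E inc. e \<in> Y D \<and> v \<notin> X D}"
      define FA where "FA = {(v, e) \<in> flags E inc. v \<in> X D \<and> e \<notin> Y D \<and> Inl (v, e) \<notin> S}"
      define FB where "FB = {(v, e) \<in> flags E inc. v \<in> X D \<and> e \<notin> Y D \<and> Inl (v, e) \<in> S}"
      have finFs: "finite FI" "finite FH" "finite FA" "finite FB"
        unfolding FI_def FH_def FA_def FB_def using finF by (auto intro: finite_subset)
      have D_eq: "D = Inl ` (FI \<union> FA) \<union> Inr ` (SIGMA e:Y D. {..<d e - 2})"
      proof (rule set_eqI)
        fix z
        show "z \<in> D \<longleftrightarrow> z \<in> Inl ` (FI \<union> FA) \<union> Inr ` (SIGMA e:Y D. {..<d e - 2})"
        proof (cases z)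
          case (Inl f)
          then show ?thesis using flag_D 4(3) YE
            by (cases f) (auto simp: FI_def FA_def flags_def)
        next
          case (Inr f)
          then show ?thesis using core_D by (cases f) auto
        qed
      qed
      have "card D = card (FI \<union> FA) + card (SIGMA e:Y D. {..<d e - 2})"
        unfolding D_eq[THEN arg_cong, of card] using finFs finY
        by (subst card_Un_disjoint) (auto simp: card_image)
      also have "card (FI \<union> FA) = card FI + card FA"
        using finFs by (intro card_Un_disjoint) (auto simp: FI_def FA_def)
      also have "card (SIGMA e:Y D. {..<d e - 2}) = (\<Sum>e\<in>Y D. d e - 2)"
        using finY by simp
      \<comment> \<open>Adding 2 for each edge of \<open>Y D\<close> undoes the truncated
        subtractions, as \<open>d e \<ge> 3\<close>. The flags at \<open>Y D\<close> are
        \<open>FI\<close> and \<open>FH\<close>, so \<open>card D\<close> and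
        \<open>card FA + card FH\<close> have the same parity.\<close>
      finally have "card D + 2 * card (Y D) = card FI + card FA + ((\<Sum>e\<in>Y D. d e - 2) + (\<Sum>e\<in>Y D. 2))"
        by simp
      also have "(\<Sum>e\<in>Y D. d e - 2) + (\<Sum>e\<in>Y D. 2) = (\<Sum>e\<in>Y D. d e)"
        unfolding sum.distrib[symmetric]
        using YE card_inc(1) c(1) by (intro sum.cong) (fastforce simp: d_def)+
      also have "\<dots> = card {(v, e) \<in> flags E inc. e \<in> Y D \<and> True}"
        by (subst card_flags[OF fin YE]) (simp add: d_def)
      also have "{(v, e) \<in> flags E inc. e \<in> Y D \<and> True} = FI \<union> FH"
        by (auto simp: FI_def FH_def)
      also have "card (FI \<union> FH) = card FI + card FH"
        using finFs by (intro card_Un_disjoint) (auto simp: FI_def FH_def)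
      finally have "card D + 2 * card (Y D) = 2 * card FI + (card FA + card FH)" by simp
      then have odd: "odd (card FA + card FH)" using dodd[OF D] by presburger
      have cut: "{(v, e) \<in> flags E inc. (v \<in> X D) \<noteq> (e \<in> Y D)} = FA \<union> FH \<union> FB"
        by (auto simp: FA_def FH_def FB_def)
      have "card (FA \<union> FH \<union> FB) = card FA + card FH + card FB"
        using finFs by (subst card_Un_disjoint card_Un_disjoint; auto simp: FA_def FH_def FB_def)+
      \<comment> \<open>An odd number is not 0, so some flag crosses the cut and
        \<open>incidence_cut\<close> applies.\<close>
      moreover have "FA \<union> FH \<noteq> {}" using odd by auto
      then obtain v0 e0 where "(v0, e0) \<in> flags E inc" "(v0 \<in> X D) \<noteq> (e0 \<in> Y D)"
        by (auto simp: FA_def FH_def)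
      from incidence_cut[OF hyp conn this]
      have "1 + nat \<lceil>real k / real c\<rceil> \<le> card (FA \<union> FH \<union> FB)" unfolding cut .
      ultimately have "1 \<le> (1 - 2 / real c) * real (card FA + card FH) + 2 / real k * card FB"
        by (intro charge_ge_1[OF c odd]) simp
      also have "\<dots> = (1 - 2 / c) * card FA + 2 / k * card FB + (1 - 2 / c) * card FH"
        by (simp add: algebra_simps)
      also have "(1 - 2 / c) * card FA + 2 / k * card FB = (\<Sum>(v, e)\<in>FA \<union> FB. p v e)"
      proof -
        \<comment> \<open>A dummy of \<open>e\<close> outside \<open>S\<close> would be adjacent to
          the flag, hence in \<open>D\<close>, and would put \<open>e\<close> into
          \<open>Y D\<close>; so all dummies of \<open>e\<close> lie in \<open>S\<close>.\<close>
        have pA: "p v e = 1 - 2 / c" if "(v, e) \<in> FA" for v e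
        proof -
          from that have f: "v \<in> inc e" "e \<in> E" "v \<in> X D" "Inl (v, e) \<notin> S" "e \<notin> Y D"
            by (auto simp: FA_def flags_def)
          then have "Inl (v, e) \<in> D" using flag_D by blast
          then have "A e" using flag_core[OF D] core_D f(5) unfolding A_def by blast
          then show ?thesis using f(4) by (simp add: p_def)
        qed
        have pB: "p v e = 2 / k" if "(v, e) \<in> FB" for v e
          using that by (auto simp: FB_def p_def)
        have "(\<Sum>(v, e)\<in>FA \<union> FB. p v e) = (\<Sum>(v, e)\<in>FA. p v e) + (\<Sum>(v, e)\<in>FB. p v e)"
          using finFs by (intro sum.union_disjoint) (auto simp: FA_def FB_def)
        also have "(\<Sum>(v, e)\<in>FA. p v e) = (\<Sum>f\<in>FA. 1 - 2 / c)"
          using pA by (intro sum.cong) auto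
        also have "(\<Sum>(v, e)\<in>FB. p v e) = (\<Sum>f\<in>FB. 2 / k)"
          using pB by (intro sum.cong) auto
        finally show ?thesis by simp
      qed
      also have "\<dots> \<le> (\<Sum>(v, e)\<in>FX D. p v e)"
        using finFX p0 by (intro sum_mono2) (auto simp: FA_def FB_def FX_def)
      \<comment> \<open>A flag of \<open>FH\<close> lies in \<open>S\<close>, since otherwise it
        would follow a dummy of its edge into \<open>D\<close>. So it leaves
        \<open>1 - 2 / k\<close> with that edge, which suffices as \<open>c \<le> k\<close>.\<close>
      also have "(1 - 2 / c) * card FH \<le> (1 - 2 / k) * card FH"
        using c by (intro mult_right_mono diff_left_mono divide_left_mono) auto
      also have "card FH \<le> card {(v, e) \<in> flags E inc. e \<in> Y D \<and> Inl (v, e) \<in> S}"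
      proof (rule card_mono)
        show "finite {(v, e) \<in> flags E inc. e \<in> Y D \<and> Inl (v, e) \<in> S}"
          using finF by (auto intro: finite_subset)
        have "Inl (v, e) \<in> S" if "v \<in> inc e" "e \<in> Y D" "v \<notin> X D" for v e
        proof (rule ccontr)
          assume "Inl (v, e) \<notin> S"
          moreover obtain i where "Inr (e, i) \<in> D" using \<open>e \<in> Y D\<close> by (auto simp: Y_def)
          ultimately have "Inl (v, e) \<in> D" using core_flag[OF D] that(1) by blast
          then show False using that(3) by (auto simp: X_def)
        qed
        then show "FH \<subseteq> {(v, e) \<in> flags E inc. e \<in> Y D \<and> Inl (v, e) \<in> S}"
          by (auto simp: FH_def flags_def)
      qed
      also have "card {(v, e) \<in> flags E inc. e \<in> Y D \<and> Inl (v, e) \<in> S} = (\<Sum>e\<in>Y D. y e)"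
        unfolding y_def by (rule card_flags[OF fin YE])
      also have "(1 - 2 / k) * real (\<Sum>e\<in>Y D. y e) \<le> (\<Sum>e\<in>Y D. Q e)"
        unfolding of_nat_sum sum_distrib_left by (intro sum_mono) (simp add: Q_def)
      finally show ?thesis using k2 s3 unfolding ch_def by (simp add: mult_left_mono)
    qed
  qed

  have "real (card P) = (\<Sum>D\<in>P. 1)" by simp
  also have "\<dots> \<le> (\<Sum>D\<in>P. ch D)" using ch_ge by (rule sum_mono)
  also have "\<dots> = (\<Sum>D\<in>P. \<Sum>(v, e)\<in>FX D. p v e) + (\<Sum>D\<in>P. \<Sum>e\<in>Y D. Q e) + (\<Sum>D\<in>P. \<Sum>z\<in>ZZ \<inter> D. 1)"
    by (simp add: ch_def sum.distrib)
  \<comment> \<open>No charge is paid out twice: different parts have disjoint \<open>X D\<close>,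
    disjoint \<open>Y D\<close> and no common dummy.\<close>
  also have "\<dots> \<le> (\<Sum>(v, e)\<in>flags E inc. p v e) + (\<Sum>e\<in>{e\<in>E. N e}. Q e) + (\<Sum>z\<in>ZZ. 1)"
  proof (intro add_mono sum_disjoint_family_le)
    fix D D' f assume DD: "D \<in> P" "D' \<in> P" and f: "f \<in> FX D" "f \<in> FX D'"
    from f obtain v e e' where "Inl (v, e) \<in> D" "Inl (v, e') \<in> D'" by (auto simp: FX_def X_def)
    moreover from this have "e' \<in> E" "v \<in> inc e'" "Inl (v, e') \<notin> S"
      using dsub[OF DD(2)] Inl_W by auto
    ultimately show "D = D'" using flag_flag[OF DD(1)] disj[OF DD] by blast
  next
    fix D D' e assume DD: "D \<in> P" "D' \<in> P" and e: "e \<in> Y D" "e \<in> Y D'"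
    then obtain i i' v where "Inr (e, i) \<in> D" "Inr (e, i') \<in> D'" "v \<in> inc e" "Inl (v, e) \<notin> S"
      using N_flag[of e] by (auto simp: Y_def)
    then show "D = D'" using core_flag[OF DD(1)] core_flag[OF DD(2)] disj[OF DD] by blast
  next
    fix D D' z assume DD: "D \<in> P" "D' \<in> P" and z: "z \<in> ZZ \<inter> D" "z \<in> ZZ \<inter> D'"
    then show "D = D'" using disj[OF DD] by blast
  qed (use finF fin finZ finP p0 Q0 in \<open>auto simp: FX_def Y_def N_def\<close>)
  also have "(\<Sum>(v, e)\<in>flags E inc. p v e) = (\<Sum>e\<in>E. \<Sum>v\<in>inc e. p v e)"
  proof -
    have "{(v, e) \<in> flags E inc. e \<in> E \<and> True} = flags E inc" by (auto simp: flags_def)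
    then show ?thesis using sum_flags[OF fin subset_refl, where R = "\<lambda>_ _. True" and g = p] by simp
  qed
  also have "(\<Sum>e\<in>{e\<in>E. N e}. Q e) = (\<Sum>e\<in>E. if N e then Q e else 0)"
    using fin(1) by (rule sum.inter_filter)
  also have "(\<Sum>z\<in>ZZ. 1) = (\<Sum>e\<in>E. if B e then real (d e - 2 - x e) else 0)"
  proof -
    have "ZZ = Inr ` (SIGMA e:{e\<in>E. B e}. {i. i < d e - 2 \<and> Inr (e, i) \<notin> S})"
      by (auto simp: ZZ_def)
    then have ZZ: "card ZZ = (\<Sum>e\<in>{e\<in>E. B e}. card {i. i < d e - 2 \<and> Inr (e, i) \<notin> S})"
      using fin(1) by (simp add: card_image)
    have "card {i. i < d e - 2 \<and> Inr (e, i) \<notin> S} = d e - 2 - x e" for e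
    proof -
      have "{i. i < d e - 2 \<and> Inr (e, i) \<notin> S} = {..<d e - 2} - {i. i < d e - 2 \<and> Inr (e, i) \<in> S}"
        by auto
      then show ?thesis unfolding x_def by (simp add: card_Diff_subset subset_iff)
    qed
    with ZZ have "real (card ZZ) = (\<Sum>e\<in>{e\<in>E. B e}. real (d e - 2 - x e))" by simp
    then show ?thesis by (simp only: sum.inter_filter[OF fin(1)] sum_constant mult_1_right of_nat_1)
  qed
  also have "(\<Sum>e\<in>E. \<Sum>v\<in>inc e. p v e) + (\<Sum>e\<in>E. if N e then Q e else 0)
      + (\<Sum>e\<in>E. if B e then real (d e - 2 - x e) else 0)
    = (\<Sum>e\<in>E. (\<Sum>v\<in>inc e. p v e) + (if N e then Q e else 0) + (if B e then real (d e - 2 - x e) else 0))"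
    by (simp only: sum.distrib)
  also have "\<dots> \<le> (\<Sum>e\<in>E. real (x e + y e))"
  proof (rule sum_mono)
    fix e assume e: "e \<in> E"
    have xd: "x e \<le> d e - 2"
      using card_mono[of "{..<d e - 2}" "{i. i < d e - 2 \<and> Inr (e, i) \<in> S}"] by (auto simp: x_def)
    have yd: "y e \<le> d e" unfolding y_def d_def using fin(2) e by (intro card_mono) auto
    have de: "c \<le> d e" "d e \<le> k" using card_inc e by (auto simp: d_def)
    have "(\<Sum>v\<in>inc e. p v e) = (\<Sum>v\<in>{v\<in>inc e. Inl (v, e) \<in> S}. 2 / k)
        + (\<Sum>v\<in>{v\<in>inc e. Inl (v, e) \<notin> S}. if A e then 1 - 2 / c else 0)"
      using fin(2) e by (simp add: p_def sum.If_cases Int_def Collect_neg_eq[symmetric])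
    also have "card {v\<in>inc e. Inl (v, e) \<notin> S} = d e - y e"
    proof -
      have "{v\<in>inc e. Inl (v, e) \<notin> S} = inc e - {v\<in>inc e. Inl (v, e) \<in> S}" by auto
      then show ?thesis using fin(2) e unfolding y_def d_def by (simp add: card_Diff_subset)
    qed
    then have "(\<Sum>v\<in>{v\<in>inc e. Inl (v, e) \<notin> S}. if A e then 1 - 2 / c else 0)
        = (if A e then (1 - 2 / c) * (real (d e) - y e) else 0)"
      using yd by simp
    finally have ps: "(\<Sum>v\<in>inc e. p v e) = 2 / k * y e
        + (if A e then (1 - 2 / c) * (real (d e) - y e) else 0)"
      by (simp add: y_def)
    have yk: "2 / k * y e \<le> 2" using yd de c by (simp add: field_simps)
    \<comment> \<open>If \<open>A e\<close>, then \<open>x e = d e - 2\<close> covers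
      \<open>(1 - 2 / c) * d e\<close> because \<open>d e \<ge> c\<close>. If \<open>B e\<close>,
      then \<open>y e = d e\<close>, and the vertices take at most 2 of it because
      \<open>d e \<le> k\<close>, leaving \<open>d e - 2\<close> for the isolated dummies. If
      \<open>N e\<close>, both shares of a flag in \<open>S\<close> add up to 1 and the balance is
      exact.\<close>
    consider "A e" | "B e" "\<not> A e" | "N e" "\<not> A e" "\<not> B e" using e by (auto simp: N_def)
    then show "(\<Sum>v\<in>inc e. p v e) + (if N e then Q e else 0)
        + (if B e then real (d e - 2 - x e) else 0) \<le> real (x e + y e)"
    proof cases
      case 1
      then have "{i. i < d e - 2 \<and> Inr (e, i) \<in> S} = {..<d e - 2}" by (auto simp: A_def)
      then have x: "real (x e) = real (d e) - 2" using de c by (simp add: x_def)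
      have "2 / k * y e \<le> 1 * real (y e)" using c by (intro mult_right_mono) auto
      moreover have "(1 - 2 / c) * (real (d e) - y e) \<le> (1 - 2 / c) * real (d e)"
        using c by (intro mult_left_mono) (auto simp: field_simps)
      moreover have "(1 - 2 / c) * real (d e) \<le> real (d e) - 2"
        using de c by (simp add: field_simps)
      ultimately show ?thesis using 1 x ps by (simp add: N_def B_def)
    next
      case 2
      then have "y e = d e" unfolding y_def d_def by (intro arg_cong[of _ _ card]) (auto simp: B_def)
      then show ?thesis using 2 ps yk xd de c by (simp add: N_def)
    next
      case 3
      then show ?thesis using ps by (simp add: Q_def algebra_simps)
    qed
  qed
  also have "(\<Sum>e\<in>E. real (x e + y e)) \<le> real (card S)"
  proof -
    let ?SF = "{(v, e) \<in> flags E inc. e \<in> E \<and> Inl (v, e) \<in> S}"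
    let ?SC = "SIGMA e:E. {i. i < d e - 2 \<and> Inr (e, i) \<in> S}"
    have "finite ?SF" using finF by (rule finite_subset[rotated]) auto
    moreover have "finite ?SC" using fin(1) by auto
    ultimately have "card (Inl ` ?SF \<union> Inr ` ?SC) = card ?SF + card ?SC"
      by (subst card_Un_disjoint) (auto simp: card_image)
    also have "card ?SF = (\<Sum>e\<in>E. y e)" unfolding y_def by (rule card_flags[OF fin subset_refl])
    also have "card ?SC = (\<Sum>e\<in>E. x e)" using fin(1) by (simp add: x_def)
    finally have "(\<Sum>e\<in>E. x e + y e) = card (Inl ` ?SF \<union> Inr ` ?SC)" by (simp add: sum.distrib)
    also have "\<dots> \<le> card S" using finite_subset[OF S finW] by (intro card_mono) auto
    finally show ?thesis by (simp only: of_nat_sum[symmetric] of_nat_le_iff)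
  qed
  finally show ?thesis by simp
qed

theorem theorem1p1:
  fixes V :: "'v set" and E :: "'e set" and inc :: "'e \<Rightarrow> 'v set"
  assumes "hypergraph V E inc"
    and "crk E inc \<ge> 3"
    and "incidence_edge_connected
           (1 + nat \<lceil>real (rk E inc) / real (crk E inc)\<rceil>) V E inc"
  shows "quasi_eulerian V E inc"
proof (cases "E = {}")
  case True
  \<comment> \<open>Without edges \<open>rk\<close> and \<open>crk\<close> are extrema of the empty
    set and carry no information; the empty family serves.\<close>
  then show ?thesis unfolding quasi_eulerian_def euler_family_def by (intro exI[of _ "[]"]) simp
next
  case False
  let ?W = "gadget_vertices E inc"
  have fin: "finite E" "\<And>e. e \<in> E \<Longrightarrow> finite (inc e)"
    using assms(1) unfolding hypergraph_def by (auto intro: finite_subset)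
  have crk: "crk E inc \<le> card (inc e)" and rk: "card (inc e) \<le> rk E inc" if "e \<in> E" for e
    using that fin(1) unfolding crk_def rk_def by auto
  then have ck: "crk E inc \<le> rk E inc" using False by (meson all_not_in_conv le_trans)
  have "finite ?W"
  proof -
    have "?W \<subseteq> Inl ` ((\<Union>e\<in>E. inc e) \<times> E) \<union> Inr ` (SIGMA e:E. {..<card (inc e) - 2})"
      by (auto simp: gadget_vertices_def flags_def)
    then show ?thesis by (rule finite_subset) (use fin in auto)
  qed
  \<comment> \<open>With \<open>c\<close> and \<open>k\<close> taken as corank and rank, the barrier
    inequality is Tutte's condition for the gadget graph.\<close>
  then obtain M where "matching gadget_edges ?W M" "\<Union>M = ?W"
    using tutte[OF _ card_gadget_edges] gadget_barrier[OF assms(1) crk rk assms(2) ck assms(3)]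
    by metis
  moreover have "2 \<le> card (inc e)" if "e \<in> E" for e using crk[OF that] assms(2) by simp
  ultimately show ?thesis using quasi_eulerian_of_gadget_matching[OF assms(1)] by blast
qed

end
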